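(* Let $b>0$, $L>0$, $B>0$, $\gamma_0>0$, $0<P_{\min}\le P_{\max}$, $\lambda\in(0,1]$ and $\Delta_{\rm th}>0$, and let $T_{\rm s}=L/B$. For a transmit power $P\in[P_{\min},P_{\max}]$ let $\epsilon(P)$ be the decoding error probability, $\mu(P)=1-\epsilon(P)$ the success probability, $\mathbb{E}\{D(P)\}$ the average delay and $\Delta_{\rm v}(P)$ the average Version Age of Information (VAoI), as defined in the context. All powers considered are assumed to satisfy the stability condition $\lambda<\mu(P)$. Then: (i) A higher decoding error probability increases the VAoI and the retransmissions: if $P,P'\in[P_{\min},P_{\max}]$ satisfy $\epsilon(P)<\epsilon(P')$, then $\mu(P)>\mu(P')$, $\Delta_{\rm v}(P)<\Delta_{\rm v}(P')$, and the expected number of transmission attempts until success satisfies $\frac{1}{1-\epsilon(P)}<\frac{1}{1-\epsilon(P')}$. (ii) If $P\in[P_{\min},P_{\max}]$ satisfies the VAoI constraint $\Delta_{\rm v}(P)\le\Delta_{\rm th}$, then $$\mathbb{E}\{D(P)\}\le D_{\max}:=\frac{T_{\rm s}\,\Delta_{\rm th}}{\lambda}.$$ (iii) If $\Delta_{\rm th}\ge\lambda$ and $P\in[P_{\min},P_{\max}]$ satisfies the VAoI constraint $\Delta_{\rm v}(P)\le\Delta_{\rm th}$, then $$\epsilon(P)\le\epsilon_{\max}:=1-\frac{\lambda}{\Delta_{\rm th}}.$$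
   Context: A wireless sensor node sends status updates to a monitoring station in slotted time. Each update has $b$ information bits and is encoded into a packet of $L$ channel uses; with bandwidth $B$ the slot duration is $T_{\rm s}=L/B$, and each transmission attempt takes one slot. In each slot a new source version arises with probability $\lambda$ (the update arrival probability). Decoding error probability (finite-blocklength normal approximation, taken as the definition of $\epsilon(P)$): with $\mathrm{SNR}(P)=P\gamma_0$ and $V(P)=1-(1+\mathrm{SNR}(P))^{-2}$, $$\epsilon(P)=Q\!\left(\sqrt{\tfrac{1}{V(P)L}}\,\bigl(L\ln(1+\mathrm{SNR}(P))-b\ln 2\bigr)\right),$$ where $Q(x)=\frac{1}{\sqrt{2\pi}}\int_x^\infty e^{-u^2/2}\,du$. The probability of successful decoding in one slot is $\mu(P)=1-\epsilon(P)$. Average delay (expected time from the first transmission attempt of an update until its successful reception): $$\mathbb{E}\{D(P)\}=\frac{T_{\rm s}}{1-\epsilon(P)}=\frac{L}{B(1-\epsilon(P))}.$$ VAoI: the number of source versions by which the monitoring station lags behind the sensor node. Under the stability condition $\lambda<\mu(P)$, its long-term average is given by $$\Delta_{\rm v}(P)=\frac{\lambda}{\mu(P)},$$ and this formula is taken as the definition of $\Delta_{\rm v}(P)$ here. *)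

theory Defs
  imports "HOL-Probability.Probability"
begin

definition gaussian_Q :: "real \<Rightarrow> real" where
  "gaussian_Q x = 1 / sqrt (2 * pi) * (LBINT u:{x..}. exp (- (u\<^sup>2) / 2))"

definition SNR :: "real \<Rightarrow> real \<Rightarrow> real" where
  "SNR \<gamma>0 P = P * \<gamma>0"

definition dispersion :: "real \<Rightarrow> real \<Rightarrow> real" where
  "dispersion \<gamma>0 P = 1 - 1 / (1 + SNR \<gamma>0 P)\<^sup>2"

text \<open>Finite-blocklength normal approximation of the decoding error probability,
  for \<open>b\<close> information bits sent over \<open>L\<close> channel uses.\<close>

definition error_prob :: "real \<Rightarrow> real \<Rightarrow> real \<Rightarrow> real \<Rightarrow> real" where
  "error_prob b L \<gamma>0 P =
     gaussian_Q (sqrt (1 / (dispersion \<gamma>0 P * L)) * (L * ln (1 + SNR \<gamma>0 P) - b * ln 2))"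

definition success_prob :: "real \<Rightarrow> real \<Rightarrow> real \<Rightarrow> real \<Rightarrow> real" where
  "success_prob b L \<gamma>0 P = 1 - error_prob b L \<gamma>0 P"

definition slot_duration :: "real \<Rightarrow> real \<Rightarrow> real" where
  "slot_duration L B = L / B"

text \<open>Each slot carries one attempt, which succeeds independently with probability
  \<open>success_prob b L \<gamma>0 P\<close>.  The library's geometric distribution counts the failures before
  the first success, so the number of attempts is one more.\<close>

definition expected_attempts :: "real \<Rightarrow> real \<Rightarrow> real \<Rightarrow> real \<Rightarrow> real" where
  "expected_attempts b L \<gamma>0 P =
     measure_pmf.expectation (geometric_pmf (success_prob b L \<gamma>0 P)) (\<lambda>n. real (n + 1))"

definition avg_delay :: "real \<Rightarrow> real \<Rightarrow> real \<Rightarrow> real \<Rightarrow> real \<Rightarrow> real" where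
  "avg_delay b L B \<gamma>0 P = slot_duration L B / (1 - error_prob b L \<gamma>0 P)"

text \<open>Long-term average Version Age of Information for update arrival probability \<open>arr\<close>,
  given by its closed form under the stability condition \<open>arr < success_prob b L \<gamma>0 P\<close>.\<close>

definition avg_VAoI :: "real \<Rightarrow> real \<Rightarrow> real \<Rightarrow> real \<Rightarrow> real \<Rightarrow> real" where
  "avg_VAoI arr b L \<gamma>0 P = arr / success_prob b L \<gamma>0 P"

end

theory Submission
  imports Defs
begin

text \<open>Everything depends on the power only through the success probability \<mu> = 1 -
  \<epsilon>. The VAoI arr/\<mu> and the mean attempt count 1/\<mu> decrease strictly in \<mu> > 0,
  so a larger \<epsilon> raises both. The delay is T/\<mu> with T the slot duration, that is T/arr
  times the VAoI, so a bound on the VAoI scales to one on the delay; solved for \<mu>, it also caps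
  \<epsilon>. The probabilistic part is \<open>expected_attempts_eq\<close>, the mean of a geometric
  law, which requires 0 < \<mu> \<le> 1; the upper bound comes from Q being nonnegative.\<close>

lemma gaussian_Q_nonneg: "0 \<le> gaussian_Q x"
  unfolding gaussian_Q_def set_lebesgue_integral_def
  \<comment> \<open>Only the sign of the integrand matters: a non-integrable function would have
    integral 0, so convergence of the Gaussian tail is not at issue.\<close>
  by (intro mult_nonneg_nonneg integral_nonneg_AE) (auto simp: indicator_def)

lemma success_prob_le_1: "success_prob b L \<gamma>0 P \<le> 1"
  using gaussian_Q_nonneg by (simp add: success_prob_def error_prob_def)

text \<open>Outside \<open>0 < p \<le> 1\<close> the library's \<open>geometric_pmf p\<close> is unspecified, so both bounds on the
  success probability matter.\<close>

lemma expected_attempts_eq: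
  assumes "0 < success_prob b L \<gamma>0 P"
  shows "expected_attempts b L \<gamma>0 P = 1 / (1 - error_prob b L \<gamma>0 P)"
proof -
  define p where "p = success_prob b L \<gamma>0 P"
  have p: "p \<in> {0<..1}"
    using assms success_prob_le_1 by (simp add: p_def)
  have "expected_attempts b L \<gamma>0 P = measure_pmf.expectation (geometric_pmf p) (\<lambda>n. real n + 1)"
    by (simp add: expected_attempts_def p_def add.commute)
  \<comment> \<open>Linearity of the Bochner integral calls for a finite mean of the failure
    count.\<close>
  also have "\<dots> = measure_pmf.expectation (geometric_pmf p) real + 1"
    using integrable_real_geometric_pmf[OF p] by (subst Bochner_Integration.integral_add) auto
  \<comment> \<open>The mean number of failures is (1 - p)/p; the final success adds 1.\<close>
  also have "\<dots> = 1 / p"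
    using p by (simp add: expectation_geometric_pmf[OF p] field_simps)
  finally show ?thesis
    by (simp add: p_def success_prob_def)
qed

theorem proposition1:
  fixes b L B \<gamma>0 Pmin Pmax arr \<Delta>th :: real
  assumes "b > 0" and "L > 0" and "B > 0" and "\<gamma>0 > 0"
    and "0 < Pmin" and "Pmin \<le> Pmax"
    and "0 < arr" and "arr \<le> 1"
    and "\<Delta>th > 0"
  shows
    "(\<forall>P\<in>{Pmin..Pmax}. \<forall>P'\<in>{Pmin..Pmax}.
        arr < success_prob b L \<gamma>0 P \<longrightarrow> arr < success_prob b L \<gamma>0 P' \<longrightarrow>
        error_prob b L \<gamma>0 P < error_prob b L \<gamma>0 P' \<longrightarrow>
          success_prob b L \<gamma>0 P > success_prob b L \<gamma>0 P' \<and>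
          avg_VAoI arr b L \<gamma>0 P < avg_VAoI arr b L \<gamma>0 P' \<and>
          expected_attempts b L \<gamma>0 P = 1 / (1 - error_prob b L \<gamma>0 P) \<and>
          expected_attempts b L \<gamma>0 P' = 1 / (1 - error_prob b L \<gamma>0 P') \<and>
          1 / (1 - error_prob b L \<gamma>0 P) < 1 / (1 - error_prob b L \<gamma>0 P'))
   \<and> (\<forall>P\<in>{Pmin..Pmax}.
        arr < success_prob b L \<gamma>0 P \<longrightarrow>
        avg_VAoI arr b L \<gamma>0 P \<le> \<Delta>th \<longrightarrow>
          avg_delay b L B \<gamma>0 P \<le> slot_duration L B * \<Delta>th / arr)
   \<and> (\<Delta>th \<ge> arr \<longrightarrow>
        (\<forall>P\<in>{Pmin..Pmax}.
          arr < success_prob b L \<gamma>0 P \<longrightarrow>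
          avg_VAoI arr b L \<gamma>0 P \<le> \<Delta>th \<longrightarrow>
            error_prob b L \<gamma>0 P \<le> 1 - arr / \<Delta>th))"
proof (intro conjI ballI impI)
  fix P P'
  assume stable: "arr < success_prob b L \<gamma>0 P" "arr < success_prob b L \<gamma>0 P'"
    and less: "error_prob b L \<gamma>0 P < error_prob b L \<gamma>0 P'"
  \<comment> \<open>Stability enters through positivity: reciprocals reverse order between positive
    numbers, and the geometric law needs p > 0.\<close>
  have pos: "0 < success_prob b L \<gamma>0 P" "0 < success_prob b L \<gamma>0 P'"
    using stable \<open>0 < arr\<close> by linarith+
  show *: "success_prob b L \<gamma>0 P > success_prob b L \<gamma>0 P'"
    using less by (simp add: success_prob_def)
  show "avg_VAoI arr b L \<gamma>0 P < avg_VAoI arr b L \<gamma>0 P'"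
    unfolding avg_VAoI_def using * pos \<open>0 < arr\<close> by (intro divide_strict_left_mono) auto
  show "expected_attempts b L \<gamma>0 P = 1 / (1 - error_prob b L \<gamma>0 P)"
    "expected_attempts b L \<gamma>0 P' = 1 / (1 - error_prob b L \<gamma>0 P')"
    using pos by (auto intro: expected_attempts_eq)
  show "1 / (1 - error_prob b L \<gamma>0 P) < 1 / (1 - error_prob b L \<gamma>0 P')"
    using * pos unfolding success_prob_def by (intro divide_strict_left_mono) auto
next
  fix P
  assume VAoI: "avg_VAoI arr b L \<gamma>0 P \<le> \<Delta>th"
  \<comment> \<open>The factor is chosen so that arr cancels and the left side becomes the average
    delay.\<close>
  have "slot_duration L B / arr * avg_VAoI arr b L \<gamma>0 P \<le> slot_duration L B / arr * \<Delta>th"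
    using VAoI assms by (intro mult_left_mono) (auto simp: slot_duration_def)
  then show "avg_delay b L B \<gamma>0 P \<le> slot_duration L B * \<Delta>th / arr"
    using \<open>0 < arr\<close> by (simp add: avg_delay_def avg_VAoI_def success_prob_def)
next
  fix P
  assume stable: "arr < success_prob b L \<gamma>0 P" and VAoI: "avg_VAoI arr b L \<gamma>0 P \<le> \<Delta>th"
  have "0 < success_prob b L \<gamma>0 P"
    using stable \<open>0 < arr\<close> by linarith
  \<comment> \<open>Positivity of both denominators lets \<mu> and \<open>\<Delta>th\<close> trade
    places.\<close>
  then have "arr / \<Delta>th \<le> success_prob b L \<gamma>0 P"
    using VAoI \<open>0 < \<Delta>th\<close> by (simp add: avg_VAoI_def field_simps)
  then show "error_prob b L \<gamma>0 P \<le> 1 - arr / \<Delta>th"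
    by (simp add: success_prob_def)
qed

end
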